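(* Let $G_1,G_2$ be simple connected graphs, each with at least one edge, with $m_1=|E(G_1)|$, $m_2=|E(G_2)|$, and let $G=G_1\oplus_vG_2$, $m=m_1+m_2$. Let $\mathscr L$ be a set of $l$ pairs of distinct vertices of $G_2$ that are not edges of $G$, let $\widehat G$ be the graph obtained from $G$ by adding the pairs in $\mathscr L$ as edges, and let $\widehat G_2$ be the graph obtained from $G_2$ by adding $\mathscr L$ (so $\widehat G=G_1\oplus_v\widehat G_2$). Set $A=\mu(\widehat G_2,v)-\mu(G_2,v)$, $B=\mathscr{K}(\widehat G_2)-\mu(G_2,v)$, $C=\mathscr{K}(\widehat G_2)-\mathscr{K}(G_2)$. Then $$\mathscr{K}(\widehat G)-\mathscr{K}(G)=\frac{lm_1(\mu(G_1,v)-\mathscr{K}(G_1))}{m(m+l)}+\frac{Am_1^2+((A+C)m_2+Bl)m_1+C(m_2^2+lm_2)}{m(m+l)}.$$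
   Context: All graphs are finite, simple, undirected. For a connected graph $H$ with Laplacian $L$, the effective resistance is $r_H(i,j)=(e_i-e_j)^TL^\dagger(e_i-e_j)$ ($L^\dagger$ the Moore–Penrose pseudoinverse), i.e. resistance with unit resistors on edges. For a connected graph $H$ with $m\ge1$ edges and degrees $d_i$, Kemeny's constant is $\mathscr{K}(H)=\sum_j\pi_jm_{ij}$ for the simple random walk ($\pi_j=d_j/2m$, $m_{ij}$ expected hitting time of $j$ from $i$, $m_{jj}=0$), equal to $\frac1{4m}\sum_{i,j}d_id_jr_H(i,j)$. The moment of a vertex $v$ of $H$ is $\mu(H,v)=\sum_{i\in V(H)}d_ir_H(i,v)$. $G_1\oplus_vG_2$ denotes the 1-sum: the disjoint union of $G_1$ and $G_2$ with a chosen vertex of each identified into a single vertex $v$. *)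

theory Defs
  imports "HOL-Probability.Probability"
begin

record 'a ugraph =
  verts :: "'a set"
  edges :: "'a set set"

definition simple_graph :: "'a ugraph \<Rightarrow> bool" where
  "simple_graph G \<longleftrightarrow>
     finite (verts G) \<and> (\<forall>e\<in>edges G. e \<subseteq> verts G \<and> card e = 2)"

definition connected_graph :: "'a ugraph \<Rightarrow> bool" where
  "connected_graph G \<longleftrightarrow>
     verts G \<noteq> {} \<and>
     (\<forall>x\<in>verts G. \<forall>y\<in>verts G. (x, y) \<in> {(a, b). {a, b} \<in> edges G}\<^sup>*)"

definition neighbours :: "'a ugraph \<Rightarrow> 'a \<Rightarrow> 'a set" where
  "neighbours G i = {j. {i, j} \<in> edges G}"

definition vdegree :: "'a ugraph \<Rightarrow> 'a \<Rightarrow> nat" where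
  "vdegree G i = card (neighbours G i)"

definition num_edges :: "'a ugraph \<Rightarrow> nat" where
  "num_edges G = card (edges G)"

definition add_edges :: "'a ugraph \<Rightarrow> 'a set set \<Rightarrow> 'a ugraph" where
  "add_edges G L = \<lparr>verts = verts G, edges = edges G \<union> L\<rparr>"

text \<open>
  The union of two graphs is their 1-sum at \<open>v\<close> exactly when the two vertex sets
  meet in the single vertex \<open>v\<close>: \<open>v\<close> is then the identified vertex and the graphs are
  otherwise disjoint. Users of this definition have to assume
  \<open>verts G1 \<inter> verts G2 = {v}\<close>.
\<close>

definition one_sum :: "'a ugraph \<Rightarrow> 'a ugraph \<Rightarrow> 'a ugraph" where
  "one_sum G1 G2 = \<lparr>verts = verts G1 \<union> verts G2, edges = edges G1 \<union> edges G2\<rparr>"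

lemma add_edges_one_sum:
  "add_edges (one_sum G1 G2) L = one_sum G1 (add_edges G2 L)"
  by (simp add: add_edges_def one_sum_def Un_assoc)

text \<open>
  Real matrices with rows and columns indexed by a finite set \<open>V\<close> are functions
  \<open>'a \<Rightarrow> 'a \<Rightarrow> real\<close> of which only the entries in \<open>V \<times> V\<close> matter. The pseudoinverse is
  normalised to 0 elsewhere, which makes it unique as a function.
\<close>

definition mmult_on :: "'a set \<Rightarrow> ('a \<Rightarrow> 'a \<Rightarrow> real) \<Rightarrow> ('a \<Rightarrow> 'a \<Rightarrow> real) \<Rightarrow> 'a \<Rightarrow> 'a \<Rightarrow> real" where
  "mmult_on V A B = (\<lambda>i j. \<Sum>k\<in>V. A i k * B k j)"

definition is_pseudoinverse_on :: "'a set \<Rightarrow> ('a \<Rightarrow> 'a \<Rightarrow> real) \<Rightarrow> ('a \<Rightarrow> 'a \<Rightarrow> real) \<Rightarrow> bool" where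
  "is_pseudoinverse_on V A X \<longleftrightarrow>
     (\<forall>i\<in>V. \<forall>j\<in>V. mmult_on V (mmult_on V A X) A i j = A i j) \<and>
     (\<forall>i\<in>V. \<forall>j\<in>V. mmult_on V (mmult_on V X A) X i j = X i j) \<and>
     (\<forall>i\<in>V. \<forall>j\<in>V. mmult_on V A X i j = mmult_on V A X j i) \<and>
     (\<forall>i\<in>V. \<forall>j\<in>V. mmult_on V X A i j = mmult_on V X A j i)"

definition pseudoinverse_on :: "'a set \<Rightarrow> ('a \<Rightarrow> 'a \<Rightarrow> real) \<Rightarrow> 'a \<Rightarrow> 'a \<Rightarrow> real" where
  "pseudoinverse_on V A =
     (THE X. is_pseudoinverse_on V A X \<and> (\<forall>i j. i \<notin> V \<or> j \<notin> V \<longrightarrow> X i j = 0))"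

definition laplacian :: "'a ugraph \<Rightarrow> 'a \<Rightarrow> 'a \<Rightarrow> real" where
  "laplacian G i j =
     (if i = j then real (vdegree G i) else if {i, j} \<in> edges G then - 1 else 0)"

definition unit_vec_at :: "'a \<Rightarrow> 'a \<Rightarrow> real" where
  "unit_vec_at i k = (if k = i then 1 else 0)"

definition eff_resistance :: "'a ugraph \<Rightarrow> 'a \<Rightarrow> 'a \<Rightarrow> real" where
  "eff_resistance G i j =
     (\<Sum>k\<in>verts G. \<Sum>l\<in>verts G.
        (unit_vec_at i k - unit_vec_at j k) *
        pseudoinverse_on (verts G) (laplacian G) k l *
        (unit_vec_at i l - unit_vec_at j l))"

definition moment :: "'a ugraph \<Rightarrow> 'a \<Rightarrow> real" where
  "moment G v = (\<Sum>i\<in>verts G. real (vdegree G i) * eff_resistance G i v)"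

text \<open>
  \<open>random_walk G n i\<close> is the law of \<open>[X\<^sub>0, \<dots>, X\<^sub>n]\<close> for the simple random walk
  on \<open>G\<close> with \<open>X\<^sub>0 = i\<close>.
\<close>

primrec random_walk :: "'a ugraph \<Rightarrow> nat \<Rightarrow> 'a \<Rightarrow> 'a list pmf" where
  "random_walk G 0 i = return_pmf [i]"
| "random_walk G (Suc n) i =
     bind_pmf (pmf_of_set (neighbours G i)) (\<lambda>k. map_pmf ((#) i) (random_walk G n k))"

text \<open>The probability that the walk started at \<open>i\<close> is at \<open>j\<close> for the first time at time \<open>n\<close>.\<close>

definition first_hit_prob :: "'a ugraph \<Rightarrow> 'a \<Rightarrow> 'a \<Rightarrow> nat \<Rightarrow> real" where
  "first_hit_prob G i j n =
     measure_pmf.prob (random_walk G n i) {xs. xs ! n = j \<and> (\<forall>k<n. xs ! k \<noteq> j)}"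

text \<open>
  This is the expectation of the hitting time whenever that is finite, as it is on a
  finite connected graph, where \<open>j\<close> is hit almost surely.
\<close>

definition hitting_time :: "'a ugraph \<Rightarrow> 'a \<Rightarrow> 'a \<Rightarrow> real" where
  "hitting_time G i j = (\<Sum>n. real n * first_hit_prob G i j n)"

definition stationary_prob :: "'a ugraph \<Rightarrow> 'a \<Rightarrow> real" where
  "stationary_prob G j = real (vdegree G j) / (2 * real (num_edges G))"

text \<open>On a connected graph the sum does not depend on the starting vertex \<open>i\<close>.\<close>

definition kemeny :: "'a ugraph \<Rightarrow> real" where
  "kemeny G =
     (let i = (SOME i. i \<in> verts G)
      in \<Sum>j\<in>verts G. stationary_prob G j * hitting_time G i j)"

end

theory Submission
  imports Defs
begin

text \<open>
  The hitting times \<open>h\<^sub>j\<close> of a vertex \<open>j\<close> satisfy \<open>L h\<^sub>j = d - 2 m e\<^sub>j\<close>, where \<open>d\<close> is the vector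
  of degrees. Hence \<open>w = (h\<^sub>j - h\<^sub>i) / 2m\<close> solves \<open>L w = e\<^sub>i - e\<^sub>j\<close>, and any solution of this
  equation has \<open>r(i,j) = w\<^sub>i - w\<^sub>j\<close>. This yields the commute time identity and the resistance
  formula for Kemeny's constant. In a 1-sum at \<open>v\<close> a potential on one summand extends to the
  other one by its value at \<open>v\<close>, so resistances in a summand are unchanged and resistances
  across \<open>v\<close> add up. Splitting the resistance formula accordingly gives
  \<open>m K(G) = m\<^sub>1 (K(G\<^sub>1) + \<mu>(G\<^sub>2,v)) + m\<^sub>2 (K(G\<^sub>2) + \<mu>(G\<^sub>1,v))\<close>, which is applied
  to \<open>G\<^sub>2\<close> and to \<open>G\<^sub>2\<close> with the new edges.
\<close>

section \<open>The Laplacian as an operator on functions\<close>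

text \<open>The sum over neighbours, unlike the matrix product, does not mention the vertex set, so
  it splits directly when the neighbour set of a 1-sum splits.\<close>

definition lap :: "'a ugraph \<Rightarrow> ('a \<Rightarrow> real) \<Rightarrow> 'a \<Rightarrow> real" where
  "lap G u i = (\<Sum>k\<in>neighbours G i. u i - u k)"

text \<open>The transition operator of the simple random walk, applied to \<open>u\<close>.\<close>

definition nbr_mean :: "'a ugraph \<Rightarrow> ('a \<Rightarrow> real) \<Rightarrow> 'a \<Rightarrow> real" where
  "nbr_mean G u i = (\<Sum>k\<in>neighbours G i. u k) / real (vdegree G i)"

lemma neighbours_sym: "k \<in> neighbours G i \<longleftrightarrow> i \<in> neighbours G k"
  by (simp add: neighbours_def insert_commute)

lemma neighbours_subset:
  assumes "simple_graph G"
  shows "neighbours G i \<subseteq> verts G - {i}"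
proof
  fix k assume "k \<in> neighbours G i"
  then have "{i, k} \<in> edges G" by (simp add: neighbours_def)
  with assms have "{i, k} \<subseteq> verts G" "card {i, k} = 2"
    by (auto simp: simple_graph_def)
  then show "k \<in> verts G - {i}" by (cases "k = i") auto
qed

lemma neighbours_outside:
  assumes "simple_graph G" "i \<notin> verts G"
  shows "neighbours G i = {}"
  using assms neighbours_subset[OF assms(1)] neighbours_sym by fastforce

lemma finite_neighbours: "simple_graph G \<Longrightarrow> finite (neighbours G i)"
  by (rule finite_subset[OF neighbours_subset]) (auto simp: simple_graph_def)

lemma finite_edges:
  assumes "simple_graph G"
  shows "finite (edges G)"
proof (rule finite_subset)
  show "edges G \<subseteq> Pow (verts G)" using assms by (auto simp: simple_graph_def)
  show "finite (Pow (verts G))" using assms by (simp add: simple_graph_def)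
qed

lemma card_incident_edges:
  assumes "simple_graph G"
  shows "card {e \<in> edges G. i \<in> e} = vdegree G i"
proof -
  have "bij_betw (\<lambda>k. {i, k}) (neighbours G i) {e \<in> edges G. i \<in> e}"
  proof (rule bij_betwI')
    fix x y assume "x \<in> neighbours G i" "y \<in> neighbours G i"
    show "({i, x} = {i, y}) = (x = y)" by (auto simp: doubleton_eq_iff)
  next
    fix x assume "x \<in> neighbours G i"
    then show "{i, x} \<in> {e \<in> edges G. i \<in> e}" by (simp add: neighbours_def)
  next
    fix e assume e: "e \<in> {e \<in> edges G. i \<in> e}"
    then have "card e = 2" using assms by (auto simp: simple_graph_def)
    with e obtain k where "e = {i, k}" by (auto simp: card_2_iff)
    with e show "\<exists>x\<in>neighbours G i. e = {i, x}" by (auto simp: neighbours_def)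
  qed
  then show ?thesis by (simp add: vdegree_def bij_betw_same_card)
qed

lemma sum_vdegree:
  assumes "simple_graph G"
  shows "(\<Sum>i\<in>verts G. real (vdegree G i)) = 2 * real (num_edges G)"
proof -
  \<comment> \<open>Incidences are counted in two ways; each edge has two ends.\<close>
  have "(\<Sum>i\<in>verts G. card {e \<in> edges G. i \<in> e}) = 2 * card (edges G)"
  proof (rule sum_multicount)
    show "\<forall>e\<in>edges G. card {i \<in> verts G. i \<in> e} = 2"
    proof
      fix e assume "e \<in> edges G"
      then have "e \<subseteq> verts G" "card e = 2" using assms by (auto simp: simple_graph_def)
      moreover from this have "{i \<in> verts G. i \<in> e} = e" by auto
      ultimately show "card {i \<in> verts G. i \<in> e} = 2" by simp
    qed
  qed (use assms finite_edges in \<open>auto simp: simple_graph_def\<close>)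
  then have "real (\<Sum>i\<in>verts G. vdegree G i) = real (2 * num_edges G)"
    by (simp add: card_incident_edges[OF assms] num_edges_def)
  then show ?thesis by simp
qed

text \<open>The diagonal entry collects the \<open>u i\<close> terms, one per neighbour; off the
  diagonal only neighbours have nonzero entries.\<close>

lemma lap_eq_laplacian:
  assumes "simple_graph G" "i \<in> verts G"
  shows "lap G u i = (\<Sum>j\<in>verts G. laplacian G i j * u j)"
proof -
  have fin: "finite (verts G)" using assms by (simp add: simple_graph_def)
  have N: "neighbours G i \<subseteq> verts G - {i}" by (rule neighbours_subset[OF assms(1)])
  have "(\<Sum>j\<in>verts G. laplacian G i j * u j)
      = laplacian G i i * u i + (\<Sum>j\<in>verts G - {i}. laplacian G i j * u j)"
    using fin assms(2) by (simp add: sum.remove)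
  also have "(\<Sum>j\<in>verts G - {i}. laplacian G i j * u j) = (\<Sum>j\<in>neighbours G i. - u j)"
    by (rule sum.mono_neutral_cong_right)
      (use fin N in \<open>auto simp: laplacian_def neighbours_def\<close>)
  finally show ?thesis
    by (simp add: lap_def laplacian_def sum_subtractf vdegree_def sum_negf)
qed

lemma laplacian_sym: "laplacian G i j = laplacian G j i"
  by (simp add: laplacian_def insert_commute)

lemma lap_self_adjoint:
  assumes "simple_graph G"
  shows "(\<Sum>i\<in>verts G. w i * lap G u i) = (\<Sum>i\<in>verts G. lap G w i * u i)"
proof -
  have "(\<Sum>i\<in>verts G. w i * lap G u i)
      = (\<Sum>i\<in>verts G. \<Sum>j\<in>verts G. w i * laplacian G i j * u j)"
    by (simp add: lap_eq_laplacian[OF assms] sum_distrib_left mult.assoc cong: sum.cong)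
  also have "\<dots> = (\<Sum>j\<in>verts G. \<Sum>i\<in>verts G. w i * laplacian G i j * u j)"
    by (rule sum.swap)
  also have "\<dots> = (\<Sum>j\<in>verts G. lap G w j * u j)"
    by (intro sum.cong refl)
      (simp add: lap_eq_laplacian[OF assms] sum_distrib_left sum_distrib_right mult_ac
        laplacian_sym)
  finally show ?thesis .
qed

text \<open>Self-adjointness tested against the constant 1, which the operator kills.\<close>

lemma sum_lap: "simple_graph G \<Longrightarrow> (\<Sum>i\<in>verts G. lap G u i) = 0"
  using lap_self_adjoint[of G "\<lambda>_. 1" u] by (simp add: lap_def)

lemma lap_diff: "lap G (\<lambda>x. u x - w x) i = lap G u i - lap G w i"
  by (simp add: lap_def algebra_simps flip: sum_subtractf)

lemma lap_scale: "lap G (\<lambda>x. c * u x) i = c * lap G u i"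
  by (simp add: lap_def sum_distrib_left algebra_simps)

lemma lap_add: "lap G (\<lambda>x. u x + w x) i = lap G u i + lap G w i"
  by (simp add: lap_def algebra_simps flip: sum.distrib)

lemma lap_sum: "lap G (\<lambda>x. \<Sum>j\<in>J. u j x) i = (\<Sum>j\<in>J. lap G (u j) i)"
  unfolding lap_def sum_subtractf[symmetric] by (rule sum.swap)

subsection \<open>Pseudoinverses\<close>

lemma mmult_on_assoc:
  "mmult_on V (mmult_on V A B) C = mmult_on V A (mmult_on V B C)"
proof (intro ext)
  fix i j
  have "(\<Sum>k\<in>V. (\<Sum>l\<in>V. A i l * B l k) * C k j) = (\<Sum>k\<in>V. \<Sum>l\<in>V. A i l * B l k * C k j)"
    by (simp add: sum_distrib_right)
  also have "\<dots> = (\<Sum>l\<in>V. \<Sum>k\<in>V. A i l * B l k * C k j)" by (rule sum.swap)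
  finally show "mmult_on V (mmult_on V A B) C i j = mmult_on V A (mmult_on V B C) i j"
    by (simp add: mmult_on_def sum_distrib_left mult.assoc)
qed

lemma mmult_on_cong:
  assumes "\<And>i j. i \<in> V \<Longrightarrow> j \<in> V \<Longrightarrow> A i j = A' i j"
    "\<And>i j. i \<in> V \<Longrightarrow> j \<in> V \<Longrightarrow> B i j = B' i j" "i \<in> V" "j \<in> V"
  shows "mmult_on V A B i j = mmult_on V A' B' i j"
  using assms by (auto simp: mmult_on_def intro!: sum.cong)

lemma mmult_on_transpose:
  "mmult_on V A B j i = mmult_on V (\<lambda>x y. B y x) (\<lambda>x y. A y x) i j"
  by (simp add: mmult_on_def mult.commute)

text \<open>Penrose's argument: first \<open>A X = A Y\<close> and \<open>X A = Y A\<close>, then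
  \<open>X = X A X = X A Y = Y A Y = Y\<close>. The equations hold only on \<open>V\<close>, so each
  replacement inside a product goes through \<open>mmult_on_cong\<close>.\<close>

lemma is_pseudoinverse_on_unique:
  assumes X: "is_pseudoinverse_on V A X" and Y: "is_pseudoinverse_on V A Y"
    and ij: "i \<in> V" "j \<in> V"
  shows "X i j = Y i j"
proof -
  let ?m = "mmult_on V"
  \<comment> \<open>Inserting \<open>A = A W A\<close> gives \<open>A Z = (A W) (A Z)\<close>; both
    factors are symmetric, so transposing swaps them.\<close>
  have AX: "?m A Z i j = ?m (?m A Z) (?m A W) j i"
    if Z: "is_pseudoinverse_on V A Z" and W: "is_pseudoinverse_on V A W"
      and ij: "i \<in> V" "j \<in> V" for Z W i j
  proof -
    have "?m A Z i j = ?m (?m (?m A W) A) Z i j"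
      by (rule mmult_on_cong) (use W ij in \<open>auto simp: is_pseudoinverse_on_def\<close>)
    also have "\<dots> = ?m (?m A W) (?m A Z) i j" by (simp add: mmult_on_assoc)
    also have "\<dots> = ?m (\<lambda>x y. ?m A W y x) (\<lambda>x y. ?m A Z y x) i j"
      by (rule mmult_on_cong) (use Z W ij in \<open>auto simp: is_pseudoinverse_on_def\<close>)
    also have "\<dots> = ?m (?m A Z) (?m A W) j i" by (rule mmult_on_transpose[symmetric])
    finally show ?thesis .
  qed
  have XA: "?m Z A i j = ?m (?m W A) (?m Z A) j i"
    if Z: "is_pseudoinverse_on V A Z" and W: "is_pseudoinverse_on V A W"
      and ij: "i \<in> V" "j \<in> V" for Z W i j
  proof -
    have "?m Z A i j = ?m Z (?m (?m A W) A) i j"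
      by (rule mmult_on_cong) (use W ij in \<open>auto simp: is_pseudoinverse_on_def\<close>)
    also have "\<dots> = ?m (?m Z A) (?m W A) i j" by (simp add: mmult_on_assoc)
    also have "\<dots> = ?m (\<lambda>x y. ?m Z A y x) (\<lambda>x y. ?m W A y x) i j"
      by (rule mmult_on_cong) (use Z W ij in \<open>auto simp: is_pseudoinverse_on_def\<close>)
    also have "\<dots> = ?m (?m W A) (?m Z A) j i" by (rule mmult_on_transpose[symmetric])
    finally show ?thesis .
  qed
  have AXY: "?m A X i j = ?m A Y i j" if ij: "i \<in> V" "j \<in> V" for i j
  proof -
    \<comment> \<open>Here \<open>A X A = A\<close> collapses the swapped product to
      \<open>A Y\<close>, which is symmetric.\<close>
    have "?m (?m A X) (?m A Y) j i = ?m (?m (?m A X) A) Y j i" by (simp add: mmult_on_assoc)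
    also have "\<dots> = ?m A Y j i"
      by (rule mmult_on_cong) (use X ij in \<open>auto simp: is_pseudoinverse_on_def\<close>)
    also have "\<dots> = ?m A Y i j" using Y ij by (auto simp: is_pseudoinverse_on_def)
    finally show ?thesis using AX[OF X Y ij] by simp
  qed
  have XAY: "?m X A i j = ?m Y A i j" if ij: "i \<in> V" "j \<in> V" for i j
  proof -
    have "?m (?m Y A) (?m X A) j i = ?m Y (?m (?m A X) A) j i" by (simp add: mmult_on_assoc)
    also have "\<dots> = ?m Y A j i"
      by (rule mmult_on_cong) (use X ij in \<open>auto simp: is_pseudoinverse_on_def\<close>)
    also have "\<dots> = ?m Y A i j" using Y ij by (auto simp: is_pseudoinverse_on_def)
    finally show ?thesis using XA[OF X Y ij] by simp
  qed
  have "X i j = ?m X (?m A X) i j"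
    using X ij by (auto simp: is_pseudoinverse_on_def simp flip: mmult_on_assoc)
  also have "\<dots> = ?m X (?m A Y) i j" by (rule mmult_on_cong) (use AXY ij in auto)
  also have "\<dots> = ?m (?m X A) Y i j" by (simp add: mmult_on_assoc)
  also have "\<dots> = ?m (?m Y A) Y i j" by (rule mmult_on_cong) (use XAY ij in auto)
  also have "\<dots> = Y i j" using Y ij by (auto simp: is_pseudoinverse_on_def)
  finally show ?thesis .
qed

text \<open>Makes the definite description usable: any pseudoinverse, cut off to 0 outside
  \<open>V\<close>, is a witness, and uniqueness on \<open>V\<close> then determines the whole
  function.\<close>

lemma is_pseudoinverse_on_pseudoinverse_on:
  assumes "is_pseudoinverse_on V A X"
  shows "is_pseudoinverse_on V A (pseudoinverse_on V A)"
proof -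
  let ?X = "\<lambda>i j. if i \<in> V \<and> j \<in> V then X i j else 0"
  let ?P = "\<lambda>X. is_pseudoinverse_on V A X \<and> (\<forall>i j. i \<notin> V \<or> j \<notin> V \<longrightarrow> X i j = 0)"
  have 1: "mmult_on V A ?X i j = mmult_on V A X i j" if "i \<in> V" "j \<in> V" for i j
    by (rule mmult_on_cong) (use that in auto)
  have 2: "mmult_on V ?X A i j = mmult_on V X A i j" if "i \<in> V" "j \<in> V" for i j
    by (rule mmult_on_cong) (use that in auto)
  have 3: "mmult_on V (mmult_on V A ?X) A i j = mmult_on V (mmult_on V A X) A i j"
    if "i \<in> V" "j \<in> V" for i j
    by (rule mmult_on_cong) (use that 1 in auto)
  have 4: "mmult_on V (mmult_on V ?X A) ?X i j = mmult_on V (mmult_on V X A) X i j"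
    if "i \<in> V" "j \<in> V" for i j
    by (rule mmult_on_cong) (use that 2 in auto)
  have P: "?P ?X"
    using assms unfolding is_pseudoinverse_on_def by (simp add: 1 2 3 4)
  have "?P (pseudoinverse_on V A)"
    unfolding pseudoinverse_on_def
  proof (rule theI[where P = ?P])
    show "?P ?X" by (rule P)
    fix Y assume Y: "?P Y"
    show "Y = ?X"
    proof (intro ext)
      fix i j
      show "Y i j = ?X i j"
        using is_pseudoinverse_on_unique[of V A Y ?X i j] Y P by (cases "i \<in> V \<and> j \<in> V") auto
    qed
  qed
  then show ?thesis by simp
qed

subsection \<open>Hitting times\<close>

text \<open>Having an edge excludes the one-vertex graph, where the walk could not move; together
  with connectedness it makes all degrees positive.\<close>

locale walk_graph =
  fixes G :: "'a ugraph"
  assumes simple: "simple_graph G" and conn: "connected_graph G" and nonempty: "edges G \<noteq> {}"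
begin

abbreviation "V \<equiv> verts G"
abbreviation "N \<equiv> neighbours G"
abbreviation "d i \<equiv> real (vdegree G i)"
abbreviation "m \<equiv> real (num_edges G)"

lemma finV: "finite V" using simple by (simp add: simple_graph_def)

lemma finN: "finite (N i)" by (rule finite_neighbours[OF simple])

lemma N_in_V: "k \<in> N i \<Longrightarrow> k \<in> V" using neighbours_subset[OF simple] by blast

lemma m_pos: "m > 0"
  using finite_edges[OF simple] nonempty by (simp add: num_edges_def card_gt_0_iff)

text \<open>Some edge has an end other than \<open>i\<close>; the first step of a path from
  \<open>i\<close> to it leads to a neighbour.\<close>

lemma N_nonempty:
  assumes "i \<in> V"
  shows "N i \<noteq> {}"
proof -
  obtain e where "e \<in> edges G" using nonempty by blast
  then have "e \<subseteq> V" "card e = 2" using simple by (auto simp: simple_graph_def)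
  then obtain k where k: "k \<in> V" "k \<noteq> i" by (auto simp: card_2_iff)
  have "(i, k) \<in> {(a, b). {a, b} \<in> edges G}\<^sup>*"
    using conn assms k by (auto simp: connected_graph_def)
  then show ?thesis
    by (cases rule: converse_rtranclE) (use k in \<open>auto simp: neighbours_def\<close>)
qed

lemma d_pos: "i \<in> V \<Longrightarrow> d i > 0"
  using N_nonempty finN by (simp add: vdegree_def card_gt_0_iff)

section \<open>Neighbour means and harmonic functions\<close>

lemma lap_eq_mean:
  assumes "i \<in> V"
  shows "lap G u i = d i * (u i - nbr_mean G u i)"
  using d_pos[OF assms]
  by (simp add: lap_def nbr_mean_def sum_subtractf vdegree_def field_simps)

lemma nbr_mean_mono:
  assumes "\<And>k. k \<in> V \<Longrightarrow> u k \<le> w k"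
  shows "nbr_mean G u i \<le> nbr_mean G w i"
  unfolding nbr_mean_def
  by (intro divide_right_mono sum_mono assms N_in_V) auto

lemma nbr_mean_const: "i \<in> V \<Longrightarrow> nbr_mean G (\<lambda>_. c) i = c"
  using d_pos by (simp add: nbr_mean_def vdegree_def)

lemma nbr_mean_add: "nbr_mean G (\<lambda>k. u k + w k) i = nbr_mean G u i + nbr_mean G w i"
  by (simp add: nbr_mean_def sum.distrib add_divide_distrib)

lemma nbr_mean_diff: "nbr_mean G (\<lambda>k. u k - w k) i = nbr_mean G u i - nbr_mean G w i"
  by (simp add: nbr_mean_def sum_subtractf diff_divide_distrib)

lemma nbr_mean_scale: "nbr_mean G (\<lambda>k. c * u k) i = c * nbr_mean G u i"
  by (simp add: nbr_mean_def sum_distrib_left)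

lemma nbr_mean_sum:
  "nbr_mean G (\<lambda>k. \<Sum>x\<in>J. u x k) i = (\<Sum>x\<in>J. nbr_mean G (u x) i)"
  by (simp add: nbr_mean_def sum.swap[of _ J] sum_divide_distrib)

text \<open>Where the maximum is attained off \<open>j\<close>, harmonicity forces it on all
  neighbours, so it spreads along a path until it reaches \<open>j\<close>.\<close>

lemma maximum_principle:
  assumes harm: "\<And>i. i \<in> V \<Longrightarrow> i \<noteq> j \<Longrightarrow> lap G u i = 0" and "j \<in> V" "x \<in> V"
  shows "u x \<le> u j"
proof -
  define M where "M = Max (u ` V)"
  have le: "u y \<le> M" if "y \<in> V" for y using finV that by (simp add: M_def)
  obtain i where i: "i \<in> V" "u i = M"
    using Max_in[of "u ` V"] finV \<open>j \<in> V\<close> unfolding M_def by fastforce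
  have "u j = M"
  proof (rule ccontr)
    assume ne: "u j \<noteq> M"
    have "(i, j) \<in> {(a, b). {a, b} \<in> edges G}\<^sup>*"
      using conn i \<open>j \<in> V\<close> by (auto simp: connected_graph_def)
    then have "j \<in> V \<and> u j = M"
    proof (induction rule: rtrancl_induct)
      case base
      show ?case using i by simp
    next
      case (step y z)
      then have z: "z \<in> N y" by (simp add: neighbours_def)
      \<comment> \<open>By induction \<open>u y = M\<close>, whereas \<open>u j\<close> was assumed
        to differ from \<open>M\<close>.\<close>
      have "y \<noteq> j" using step ne by auto
      then have "(\<Sum>k\<in>N y. u y - u k) = 0" using harm step.IH unfolding lap_def by blast
      moreover have "\<forall>k\<in>N y. 0 \<le> u y - u k" using step le N_in_V by auto
      ultimately have "\<forall>k\<in>N y. u y - u k = 0" by (simp add: sum_nonneg_eq_0_iff finN)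
      with z step N_in_V[OF z] show ?case by auto
    qed
    with ne show False by simp
  qed
  with le \<open>x \<in> V\<close> show ?thesis by simp
qed

text \<open>The maximum principle twice, with \<open>x\<close> and \<open>y\<close> in turn as the
  exceptional vertex.\<close>

lemma harmonic_const:
  assumes "\<And>i. i \<in> V \<Longrightarrow> lap G u i = 0" "x \<in> V" "y \<in> V"
  shows "u x = u y"
  using maximum_principle[of y u x] maximum_principle[of x u y] assms by fastforce

section \<open>First-hit and survival probabilities\<close>

lemma finite_random_walk: "i \<in> V \<Longrightarrow> finite (set_pmf (random_walk G n i))"
  by (induction n arbitrary: i) (auto simp: N_nonempty finN N_in_V)

lemma first_hit_prob_0: "first_hit_prob G i j 0 = (if i = j then 1 else 0)"
  by (simp add: first_hit_prob_def)

text \<open>First-step analysis: after the uniform choice of a neighbour, the event for the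
  remaining path is the same event one step earlier.\<close>

lemma first_hit_prob_Suc:
  assumes "i \<in> V"
  shows "first_hit_prob G i j (Suc n) =
    (if i = j then 0 else nbr_mean G (\<lambda>k. first_hit_prob G k j n) i)"
proof -
  let ?S = "\<lambda>n. {xs. xs ! n = j \<and> (\<forall>k<n. xs ! k \<noteq> j)}"
  \<comment> \<open>A path starting at \<open>j\<close> hits it at time 0, hence never first at time
    \<open>Suc n\<close>.\<close>
  have pre: "(#) i -` ?S (Suc n) = (if i = j then {} else ?S n)"
    by (auto simp: less_Suc_eq_0_disj)
  have "measure_pmf.prob (random_walk G (Suc n) i) (?S (Suc n))
      = measure_pmf.expectation (random_walk G (Suc n) i) (indicat_real (?S (Suc n)))"
    by simp
  also have "\<dots> = (\<Sum>k\<in>N i. measure_pmf.expectation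
      (map_pmf ((#) i) (random_walk G n k)) (indicat_real (?S (Suc n))) / real (card (N i)))"
    unfolding random_walk.simps
    by (subst pmf_expectation_bind_pmf_of_set)
      (auto simp: finN N_nonempty assms N_in_V finite_random_walk divide_inverse mult.commute)
  also have "\<dots> = (\<Sum>k\<in>N i. measure_pmf.prob (map_pmf ((#) i) (random_walk G n k)) (?S (Suc n))
      / real (card (N i)))"
    by simp
  also have "\<dots> = (\<Sum>k\<in>N i. measure_pmf.prob (random_walk G n k) (if i = j then {} else ?S n)
      / real (card (N i)))"
    by (simp only: measure_map_pmf pre)
  finally show ?thesis
    by (simp add: first_hit_prob_def nbr_mean_def vdegree_def sum_divide_distrib)
qed

lemma first_hit_prob_nonneg: "first_hit_prob G i j n \<ge> 0"
  by (simp add: first_hit_prob_def)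

text \<open>The probability of avoiding \<open>j\<close> at all times up to \<open>n\<close>. The
  start comes last so that \<open>nbr_mean\<close> applies to \<open>survival j n\<close>.\<close>

definition survival :: "'a \<Rightarrow> nat \<Rightarrow> 'a \<Rightarrow> real" where
  "survival j n i = 1 - (\<Sum>k\<le>n. first_hit_prob G i j k)"

lemma survival_0: "survival j 0 i = (if i = j then 0 else 1)"
  by (simp add: survival_def first_hit_prob_0)

lemma survival_Suc:
  assumes "i \<in> V"
  shows "survival j (Suc n) i = (if i = j then 0 else nbr_mean G (survival j n) i)"
proof -
  have "survival j (Suc n) i = 1 - first_hit_prob G i j 0 - (\<Sum>k\<le>n. first_hit_prob G i j (Suc k))"
    unfolding survival_def by (subst sum.atMost_Suc_shift) simp
  also have "\<dots> = (if i = j then 0 else nbr_mean G (survival j n) i)"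
    by (simp add: first_hit_prob_0 first_hit_prob_Suc[OF assms] survival_def[abs_def]
        nbr_mean_diff nbr_mean_const[OF assms] nbr_mean_sum)
  finally show ?thesis .
qed

lemma survival_self: "j \<in> V \<Longrightarrow> survival j n j = 0"
  by (cases n) (auto simp: survival_0 survival_Suc)

lemma survival_nonneg: "i \<in> V \<Longrightarrow> survival j n i \<ge> 0"
proof (induction n arbitrary: i)
  case (Suc n)
  have "nbr_mean G (\<lambda>_. 0) i \<le> nbr_mean G (survival j n) i"
    by (rule nbr_mean_mono) (rule Suc.IH)
  then show ?case using Suc.prems by (simp add: survival_Suc nbr_mean_const)
qed (simp add: survival_0)

lemma decseq_survival: "decseq (\<lambda>n. survival j n i)"
  by (rule decseq_SucI) (simp add: survival_def first_hit_prob_nonneg)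

text \<open>The limit of the survival probabilities is harmonic off \<open>j\<close> and vanishes at \<open>j\<close>.\<close>

lemma survival_tendsto_0:
  assumes "j \<in> V" "i \<in> V"
  shows "(\<lambda>n. survival j n i) \<longlonglongrightarrow> 0"
proof -
  define s where "s = (\<lambda>i. lim (\<lambda>n. survival j n i))"
  have lim: "(\<lambda>n. survival j n i) \<longlonglongrightarrow> s i" if "i \<in> V" for i
  proof -
    have "convergent (\<lambda>n. survival j n i)"
      using decseq_convergent[OF decseq_survival, of 0 j i] survival_nonneg[OF that]
      by (metis convergentI)
    then show ?thesis by (simp add: s_def convergent_LIMSEQ_iff)
  qed
  have harm: "lap G s i = 0" if i: "i \<in> V" "i \<noteq> j" for i
  proof -
    have "(\<lambda>n. nbr_mean G (survival j n) i) \<longlonglongrightarrow> nbr_mean G s i"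
      unfolding nbr_mean_def
      by (intro tendsto_divide tendsto_sum tendsto_const lim N_in_V) (use d_pos i in auto)
    \<comment> \<open>The means are the survival probabilities one step later, so they share the
      limit.\<close>
    moreover have "(\<lambda>n. nbr_mean G (survival j n) i) \<longlonglongrightarrow> s i"
      using LIMSEQ_Suc[OF lim[OF i(1)]] i by (simp add: survival_Suc)
    ultimately have "nbr_mean G s i = s i" by (rule LIMSEQ_unique)
    then show ?thesis using i by (simp add: lap_eq_mean)
  qed
  have "s j = 0" using lim[OF assms(1)] by (simp add: survival_self[OF assms(1)] LIMSEQ_const_iff)
  with maximum_principle[of j s i] harm assms have "s i \<le> 0" by simp
  moreover have "s i \<ge> 0"
    using LIMSEQ_le_const[OF lim[OF assms(2)]] survival_nonneg[OF assms(2)] by blast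
  ultimately show ?thesis using lim[OF assms(2)] by simp
qed

text \<open>The partial sums are 1 minus the survival probabilities; the vertex \<open>j\<close> is
  hit almost surely.\<close>

lemma first_hit_prob_sums:
  assumes "j \<in> V" "i \<in> V"
  shows "first_hit_prob G i j sums 1"
proof -
  have "(\<lambda>n. 1 - survival j n i) \<longlonglongrightarrow> 1 - 0"
    by (intro tendsto_diff tendsto_const survival_tendsto_0 assms)
  then show ?thesis by (simp add: sums_def_le survival_def)
qed

text \<open>
  If the walk survives \<open>n0\<close> steps with probability at most 1/2 from every vertex, then
  twice the sum of the first \<open>n0\<close> survival probabilities dominates the hitting time.
\<close>

lemma hitting_time_supersolution:
  assumes "j \<in> V"
  obtains g where "\<And>i. i \<in> V \<Longrightarrow> g i \<ge> 0"
    "\<And>i. i \<in> V \<Longrightarrow> i \<noteq> j \<Longrightarrow> 1 + nbr_mean G g i \<le> g i"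
proof -
  \<comment> \<open>As \<open>V\<close> is finite, one time serves all starting vertices.\<close>
  have "\<forall>\<^sub>F n in sequentially. \<forall>i\<in>V. survival j n i < 1 / 2"
    by (intro eventually_ball_finite finV ballI order_tendstoD(2)[OF survival_tendsto_0] assms) auto
  then obtain n0 where n0: "\<And>i. i \<in> V \<Longrightarrow> survival j n0 i < 1 / 2"
    by (auto simp: eventually_sequentially)
  define g where "g = (\<lambda>i. 2 * (\<Sum>n<n0. survival j n i))"
  show thesis
  proof
    show "g i \<ge> 0" if "i \<in> V" for i
      using survival_nonneg[OF that] by (simp add: g_def sum_nonneg)
    show "1 + nbr_mean G g i \<le> g i" if i: "i \<in> V" "i \<noteq> j" for i
    proof -
      have "nbr_mean G g i = 2 * (\<Sum>n<n0. survival j (Suc n) i)"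
        using i by (simp add: g_def nbr_mean_scale nbr_mean_sum survival_Suc)
      \<comment> \<open>Telescoping leaves the term at \<open>n0\<close>, below 1/2, and the term at
        0, equal to 1 off \<open>j\<close>; after doubling, the mean drops by at least 1.\<close>
      also have "(\<Sum>n<n0. survival j (Suc n) i)
          = (\<Sum>n<n0. survival j n i) + survival j n0 i - survival j 0 i"
        by (induction n0) auto
      finally show ?thesis using n0[OF i(1)] i by (simp add: g_def survival_0)
    qed
  qed
qed

text \<open>The supersolution \<open>g\<close> bounds every partial sum: by induction, a partial sum
  at \<open>i\<close> is at most the mean of \<open>1 + g\<close> over the neighbours, hence at most
  \<open>g i\<close>.\<close>

lemma summable_hitting_time:
  assumes "j \<in> V" "i \<in> V"
  shows "summable (\<lambda>n. real n * first_hit_prob G i j n)"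
proof -
  obtain g where g0: "\<And>i. i \<in> V \<Longrightarrow> g i \<ge> 0"
    and g: "\<And>i. i \<in> V \<Longrightarrow> i \<noteq> j \<Longrightarrow> 1 + nbr_mean G g i \<le> g i"
    using hitting_time_supersolution[OF assms(1)] by blast
  have bound: "(\<Sum>n\<le>M. real n * first_hit_prob G i j n) \<le> g i" if "i \<in> V" for M i
    using that
  proof (induction M arbitrary: i)
    case 0
    then show ?case using g0 by simp
  next
    case (Suc M)
    let ?f = "\<lambda>k n. first_hit_prob G k j n"
    show ?case
    proof (cases "i = j")
      case True
      have "(\<Sum>n\<le>Suc M. real n * ?f i n) = (\<Sum>n\<le>M. real (Suc n) * ?f i (Suc n))"
        by (subst sum.atMost_Suc_shift) simp
      then show ?thesis using True g0[OF Suc.prems] Suc.prems by (simp add: first_hit_prob_Suc)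
    next
      case False
      have "(\<Sum>n\<le>Suc M. real n * ?f i n) = (\<Sum>n\<le>M. real (Suc n) * ?f i (Suc n))"
        by (subst sum.atMost_Suc_shift) simp
      also have "\<dots> = nbr_mean G (\<lambda>k. \<Sum>n\<le>M. real (Suc n) * ?f k n) i"
        using False Suc.prems
        by (simp add: first_hit_prob_Suc nbr_mean_sum nbr_mean_scale del: of_nat_Suc)
      also have "\<dots> \<le> nbr_mean G (\<lambda>k. 1 + g k) i"
      proof (rule nbr_mean_mono)
        fix k assume k: "k \<in> V"
        \<comment> \<open>The extra unit of time is weighted by a total hitting probability of at
          most 1.\<close>
        have "(\<Sum>n\<le>M. real (Suc n) * ?f k n) = (\<Sum>n\<le>M. ?f k n) + (\<Sum>n\<le>M. real n * ?f k n)"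
          by (simp add: algebra_simps sum.distrib)
        also have "(\<Sum>n\<le>M. ?f k n) \<le> 1"
          using survival_nonneg[OF k, of j M] by (simp add: survival_def)
        finally show "(\<Sum>n\<le>M. real (Suc n) * ?f k n) \<le> 1 + g k" using Suc.IH[OF k] by simp
      qed
      also have "\<dots> = 1 + nbr_mean G g i" using Suc.prems by (simp add: nbr_mean_add nbr_mean_const)
      also have "\<dots> \<le> g i" using g False Suc.prems by simp
      finally show ?thesis .
    qed
  qed
  show ?thesis
  proof (rule bounded_imp_summable)
    show "0 \<le> real n * first_hit_prob G i j n" for n by (simp add: first_hit_prob_nonneg)
    show "(\<Sum>n\<le>M. real n * first_hit_prob G i j n) \<le> g i" for M by (rule bound[OF assms(2)])
  qed
qed

section \<open>Equations for the hitting times\<close>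

lemma hitting_time_self: "j \<in> V \<Longrightarrow> hitting_time G j j = 0"
proof -
  assume j: "j \<in> V"
  have "(\<lambda>n. real n * first_hit_prob G j j n) = (\<lambda>_. 0)"
  proof
    show "real n * first_hit_prob G j j n = 0" for n
      by (cases n) (auto simp: first_hit_prob_Suc[OF j])
  qed
  then show ?thesis unfolding hitting_time_def by simp
qed

text \<open>Since the hitting probabilities sum to 1, delaying by one step adds exactly 1 to the
  expectation.\<close>

lemma hitting_time_step:
  assumes "j \<in> V" "i \<in> V" "i \<noteq> j"
  shows "hitting_time G i j = 1 + nbr_mean G (\<lambda>k. hitting_time G k j) i"
proof -
  let ?f = "\<lambda>k n. first_hit_prob G k j n"
  have s: "(\<lambda>n. real n * ?f k n + ?f k n) sums (hitting_time G k j + 1)" if "k \<in> V" for k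
    unfolding hitting_time_def
    by (intro sums_add summable_sums summable_hitting_time first_hit_prob_sums assms that)
  have "(\<lambda>n. nbr_mean G (\<lambda>k. real n * ?f k n + ?f k n) i)
      sums nbr_mean G (\<lambda>k. hitting_time G k j + 1) i"
    unfolding nbr_mean_def by (intro sums_divide sums_sum s N_in_V)
  moreover have "nbr_mean G (\<lambda>k. real n * ?f k n + ?f k n) i = real (Suc n) * ?f i (Suc n)" for n
    using assms by (simp add: nbr_mean_add nbr_mean_scale first_hit_prob_Suc algebra_simps)
  ultimately have "(\<lambda>n. real (Suc n) * ?f i (Suc n))
      sums (1 + nbr_mean G (\<lambda>k. hitting_time G k j) i)"
    using assms by (simp add: nbr_mean_add nbr_mean_const add.commute del: of_nat_Suc)
  \<comment> \<open>The index shift is harmless because the term at time 0 is 0.\<close>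
  then have "(\<lambda>n. real n * ?f i n) sums (1 + nbr_mean G (\<lambda>k. hitting_time G k j) i)"
    by (subst (asm) sums_Suc_iff) simp
  then show ?thesis unfolding hitting_time_def by (rule sums_unique[symmetric])
qed

text \<open>Off \<open>j\<close> this is the one-step equation. The value at \<open>j\<close> is
  then forced, because the Laplacian sums to 0 and the degrees to \<open>2 * m\<close>.\<close>

lemma lap_hitting_time:
  assumes "j \<in> V" "i \<in> V"
  shows "lap G (\<lambda>k. hitting_time G k j) i = d i - 2 * m * unit_vec_at j i"
proof -
  let ?h = "\<lambda>k. hitting_time G k j"
  have off: "lap G ?h i = d i" if "i \<in> V" "i \<noteq> j" for i
    using that assms hitting_time_step[of j i] by (simp add: lap_eq_mean)
  have "0 = lap G ?h j + (\<Sum>i\<in>V - {j}. lap G ?h i)"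
    using sum_lap[OF simple, of ?h] assms(1) finV by (simp add: sum.remove)
  also have "(\<Sum>i\<in>V - {j}. lap G ?h i) = (\<Sum>i\<in>V - {j}. d i)"
    by (rule sum.cong) (auto simp: off)
  also have "\<dots> = 2 * m - d j"
    using sum_vdegree[OF simple] assms(1) finV by (simp add: sum.remove)
  finally have "lap G ?h j = d j - 2 * m" by simp
  with off assms show ?thesis by (auto simp: unit_vec_at_def)
qed

text \<open>The voltage of a unit current from \<open>i\<close> to \<open>j\<close>; the degree
  terms cancel in the difference of the hitting times.\<close>

definition potential :: "'a \<Rightarrow> 'a \<Rightarrow> 'a \<Rightarrow> real" where
  "potential i j x = 1 / (2 * m) * (hitting_time G x j - hitting_time G x i)"

lemma lap_potential:
  assumes "i \<in> V" "j \<in> V" "x \<in> V"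
  shows "lap G (potential i j) x = unit_vec_at i x - unit_vec_at j x"
  unfolding potential_def[abs_def] lap_scale lap_diff
  using m_pos by (simp add: lap_hitting_time assms field_simps)

subsection \<open>Effective resistance\<close>

text \<open>
  Averaging the potentials over their sink and centring gives a matrix \<open>X\<close> with column
  sums 0 and \<open>L X = P\<close>, the projection along constants. Then \<open>X = P X = X\<^sup>T L X\<close> is
  symmetric, so also \<open>X L = P\<close>.
\<close>

lemma pseudoinverse_exists: "\<exists>X. is_pseudoinverse_on V (laplacian G) X"
proof -
  define n where "n = real (card V)"
  have n: "n > 0" using conn finV by (simp add: n_def card_gt_0_iff connected_graph_def)
  define P :: "'a \<Rightarrow> 'a \<Rightarrow> real" where "P = (\<lambda>i j. unit_vec_at j i - 1 / n)"
  define Y where "Y = (\<lambda>i j. 1 / n * (\<Sum>k\<in>V. potential j k i))"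
  define X where "X = (\<lambda>i j. Y i j - 1 / n * (\<Sum>i\<in>V. Y i j))"
  let ?L = "laplacian G" and ?m = "mmult_on V"
  have P_sym: "P i j = P j i" for i j by (simp add: P_def unit_vec_at_def)
  have unit: "(\<Sum>k\<in>V. unit_vec_at a k * u k) = u a" if "a \<in> V" for a u
    using finV that by (simp add: unit_vec_at_def if_distrib[of "\<lambda>x. x * _"] cong: if_cong)
  have unit': "(\<Sum>k\<in>V. unit_vec_at k a * u k) = u a" if "a \<in> V" for a u
    using unit[OF that] by (simp add: unit_vec_at_def eq_commute)
  have L_lap: "?m ?L Z i j = lap G (\<lambda>x. Z x j) i" if "i \<in> V" for Z i j
    by (simp add: mmult_on_def lap_eq_laplacian[OF simple that])
  have LX: "?m ?L X i j = P i j" if "i \<in> V" "j \<in> V" for i j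
  proof -
    have "?m ?L X i j = lap G (\<lambda>x. Y x j) i"
      using that by (simp add: L_lap X_def lap_diff) (simp add: lap_def)
    also have "\<dots> = 1 / n * (\<Sum>k\<in>V. unit_vec_at j i - unit_vec_at k i)"
      unfolding Y_def lap_scale lap_sum using that by (simp add: lap_potential)
    also have "\<dots> = P i j"
      using unit'[OF that(1), of "\<lambda>_. 1"] n
      by (simp add: sum_subtractf P_def field_simps flip: n_def)
    finally show ?thesis .
  qed
  have col: "(\<Sum>i\<in>V. X i j) = 0" for j
    using n by (simp add: X_def sum_subtractf flip: n_def)
  have PX: "?m P X i j = X i j" if "i \<in> V" "j \<in> V" for i j
    using col unit'[OF that(1)]
    by (simp add: mmult_on_def P_def left_diff_distrib sum_subtractf flip: sum_divide_distrib)
  have PL: "?m P ?L i j = ?L i j" if "i \<in> V" "j \<in> V" for i j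
  proof -
    have "(\<Sum>k\<in>V. ?L k j) = lap G (\<lambda>_. 1) j"
      using that by (simp add: lap_eq_laplacian[OF simple] laplacian_sym[of G j])
    then have "(\<Sum>k\<in>V. ?L k j) = 0" by (simp add: lap_def)
    then show ?thesis
      using unit'[OF that(1)]
      by (simp add: mmult_on_def P_def left_diff_distrib sum_subtractf flip: sum_divide_distrib)
  qed
  have XtL: "?m (\<lambda>i j. X j i) ?L i j = P i j" if "i \<in> V" "j \<in> V" for i j
  proof -
    have "?m (\<lambda>i j. X j i) ?L i j = ?m ?L X j i"
      by (simp add: mmult_on_def laplacian_sym[of G _ j] mult.commute)
    then show ?thesis using LX[of j i] that P_sym by simp
  qed
  have X_quad: "X i j = ?m (?m (\<lambda>i j. X j i) ?L) X i j" if "i \<in> V" "j \<in> V" for i j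
    using PX[OF that] mmult_on_cong[of V "?m (\<lambda>i j. X j i) ?L" P X X i j] XtL that by simp
  have X_sym: "X i j = X j i" if "i \<in> V" "j \<in> V" for i j
  proof -
    have "X j i = ?m (?m (\<lambda>i j. X j i) ?L) X j i" by (rule X_quad) (use that in auto)
    \<comment> \<open>Transposing \<open>X^T L X\<close> reproduces it, since \<open>L\<close> is
      symmetric.\<close>
    also have "\<dots> = ?m (\<lambda>i j. X j i) (\<lambda>i j. ?m (\<lambda>i j. X j i) ?L j i) i j"
      by (rule mmult_on_transpose)
    also have "(\<lambda>i j. ?m (\<lambda>i j. X j i) ?L j i) = ?m ?L X"
      by (simp add: mmult_on_def fun_eq_iff laplacian_sym[of G _ j for j] mult.commute)
    finally show ?thesis using X_quad[OF that] by (simp add: mmult_on_assoc)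
  qed
  have XL: "?m X ?L i j = P i j" if "i \<in> V" "j \<in> V" for i j
    using XtL[OF that] mmult_on_cong[of V X "\<lambda>i j. X j i" ?L ?L i j] X_sym that by simp
  have "is_pseudoinverse_on V ?L X"
    unfolding is_pseudoinverse_on_def
  proof (intro conjI ballI)
    fix i j assume ij: "i \<in> V" "j \<in> V"
    show "?m (?m ?L X) ?L i j = ?L i j"
      using PL[OF ij] mmult_on_cong[of V "?m ?L X" P ?L ?L i j] LX ij by simp
    show "?m (?m X ?L) X i j = X i j"
      using PX[OF ij] mmult_on_cong[of V "?m X ?L" P X X i j] XL ij by simp
    show "?m ?L X i j = ?m ?L X j i" using LX ij P_sym by simp
    show "?m X ?L i j = ?m X ?L j i" using XL ij P_sym by simp
  qed
  then show ?thesis by blast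
qed

text \<open>With \<open>u = X L w\<close>, the resistance is the inner product of \<open>L w\<close>
  and \<open>u\<close>. From \<open>L X L = L\<close> follows \<open>L u = L w\<close>, so
  self-adjointness turns it into the inner product of \<open>w\<close> with
  \<open>e_i - e_j\<close>.\<close>

lemma eff_resistance_eq_potential_diff:
  assumes w: "\<And>x. x \<in> V \<Longrightarrow> lap G w x = unit_vec_at i x - unit_vec_at j x"
    and ij: "i \<in> V" "j \<in> V"
  shows "eff_resistance G i j = w i - w j"
proof -
  let ?L = "laplacian G" and ?m = "mmult_on V"
  define X where "X = pseudoinverse_on V ?L"
  have LXL: "?m ?L (?m X ?L) a b = ?L a b" if "a \<in> V" "b \<in> V" for a b
  proof -
    have "is_pseudoinverse_on V ?L X"
      using pseudoinverse_exists is_pseudoinverse_on_pseudoinverse_on unfolding X_def by blast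
    then show ?thesis using that by (simp add: is_pseudoinverse_on_def mmult_on_assoc)
  qed
  define u where "u = (\<lambda>k. \<Sum>l\<in>V. X k l * lap G w l)"
  have u: "lap G u a = lap G w a" if a: "a \<in> V" for a
  proof -
    have "u k = (\<Sum>b\<in>V. ?m X ?L k b * w b)" for k
    proof -
      have "u k = (\<Sum>l\<in>V. \<Sum>b\<in>V. X k l * ?L l b * w b)"
        by (simp add: u_def lap_eq_laplacian[OF simple] sum_distrib_left mult.assoc cong: sum.cong)
      also have "\<dots> = (\<Sum>b\<in>V. \<Sum>l\<in>V. X k l * ?L l b * w b)" by (rule sum.swap)
      finally show ?thesis by (simp add: mmult_on_def sum_distrib_right)
    qed
    then have "lap G u a = (\<Sum>k\<in>V. \<Sum>b\<in>V. ?L a k * ?m X ?L k b * w b)"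
      by (simp add: lap_eq_laplacian[OF simple a] sum_distrib_left mult.assoc)
    also have "\<dots> = (\<Sum>b\<in>V. \<Sum>k\<in>V. ?L a k * ?m X ?L k b * w b)" by (rule sum.swap)
    also have "\<dots> = (\<Sum>b\<in>V. ?m ?L (?m X ?L) a b * w b)"
      by (simp add: mmult_on_def[of V ?L] sum_distrib_right)
    also have "\<dots> = lap G w a"
      using a by (simp add: LXL lap_eq_laplacian[OF simple a] cong: sum.cong)
    finally show ?thesis .
  qed
  have "eff_resistance G i j = (\<Sum>k\<in>V. lap G w k * u k)"
    unfolding eff_resistance_def X_def[symmetric] u_def
    by (simp add: w sum_distrib_left mult.assoc cong: sum.cong)
  also have "\<dots> = (\<Sum>k\<in>V. w k * lap G u k)" by (rule lap_self_adjoint[OF simple, symmetric])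
  also have "\<dots> = (\<Sum>k\<in>V. w k * unit_vec_at i k - w k * unit_vec_at j k)"
    by (intro sum.cong) (auto simp: u w right_diff_distrib)
  also have "\<dots> = w i - w j"
    using finV ij by (simp add: sum_subtractf unit_vec_at_def if_distrib[of "\<lambda>x. _ * x"] cong: if_cong)
  finally show ?thesis .
qed

lemma eff_resistance_potential:
  "i \<in> V \<Longrightarrow> j \<in> V \<Longrightarrow> eff_resistance G i j = potential i j i - potential i j j"
  by (rule eff_resistance_eq_potential_diff) (auto simp: lap_potential)

section \<open>Commute times and Kemeny's constant\<close>

lemma commute_time:
  assumes "i \<in> V" "j \<in> V"
  shows "hitting_time G i j + hitting_time G j i = 2 * m * eff_resistance G i j"
  using m_pos assms
  by (simp add: eff_resistance_potential potential_def hitting_time_self field_simps)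

lemma eff_resistance_sym:
  "i \<in> V \<Longrightarrow> j \<in> V \<Longrightarrow> eff_resistance G i j = eff_resistance G j i"
  using commute_time[of i j] commute_time[of j i] m_pos by (simp add: add.commute)

text \<open>As a function of the start the sum is harmonic everywhere: at \<open>x\<close> its
  Laplacian is \<open>2 * m * d x - 2 * m * d x\<close>. So it is constant, and the start chosen by
  \<open>SOME\<close> can be replaced by \<open>i\<close>.\<close>

lemma kemeny_start:
  assumes "i \<in> V"
  shows "(\<Sum>j\<in>V. d j * hitting_time G i j) = 2 * m * kemeny G"
proof -
  let ?u = "\<lambda>x. \<Sum>j\<in>V. d j * hitting_time G x j"
  have some: "(SOME i. i \<in> V) \<in> V" using assms by (rule someI)
  have "lap G ?u x = 0" if x: "x \<in> V" for x
  proof -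
    have "lap G ?u x = (\<Sum>j\<in>V. d j * d x - 2 * m * (d j * unit_vec_at j x))"
      unfolding lap_sum lap_scale using x
      by (intro sum.cong) (auto simp: lap_hitting_time algebra_simps)
    also have "\<dots> = (\<Sum>j\<in>V. d j) * d x - 2 * m * (\<Sum>j\<in>V. d j * unit_vec_at j x)"
      by (simp add: sum_subtractf sum_distrib_left sum_distrib_right)
    also have "(\<Sum>j\<in>V. d j * unit_vec_at j x) = d x"
      using finV x by (simp add: unit_vec_at_def if_distrib[of "\<lambda>x. _ * x"] cong: if_cong)
    finally show ?thesis by (simp add: sum_vdegree[OF simple])
  qed
  then have "?u i = ?u (SOME i. i \<in> V)" using assms some by (rule harmonic_const)
  also have "\<dots> = 2 * m * kemeny G"
    using m_pos by (simp add: kemeny_def stationary_prob_def sum_distrib_left)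
  finally show ?thesis .
qed

text \<open>Summing \<open>kemeny_start\<close> over all starts with degree weights, once in each
  direction, turns hitting times into commute times.\<close>

lemma kemeny_eff_resistance:
  "4 * m * kemeny G = (\<Sum>i\<in>V. \<Sum>j\<in>V. d i * d j * eff_resistance G i j)"
proof -
  let ?h = "hitting_time G"
  have H: "(\<Sum>i\<in>V. \<Sum>j\<in>V. d i * d j * ?h i j) = 2 * m * (2 * m * kemeny G)"
  proof -
    have "(\<Sum>i\<in>V. \<Sum>j\<in>V. d i * d j * ?h i j) = (\<Sum>i\<in>V. d i * (2 * m * kemeny G))"
    proof (rule sum.cong[OF refl])
      fix i assume "i \<in> V"
      show "(\<Sum>j\<in>V. d i * d j * ?h i j) = d i * (2 * m * kemeny G)"
        unfolding kemeny_start[OF \<open>i \<in> V\<close>, symmetric] by (simp only: sum_distrib_left mult.assoc)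
    qed
    then show ?thesis by (simp add: sum_vdegree[OF simple] flip: sum_distrib_right)
  qed
  have H': "(\<Sum>i\<in>V. \<Sum>j\<in>V. d i * d j * ?h j i) = 2 * m * (2 * m * kemeny G)"
    unfolding H[symmetric] by (subst sum.swap) (simp add: mult.commute)
  have "2 * m * (\<Sum>i\<in>V. \<Sum>j\<in>V. d i * d j * eff_resistance G i j)
      = (\<Sum>i\<in>V. \<Sum>j\<in>V. d i * d j * (?h i j + ?h j i))"
    unfolding sum_distrib_left
    by (intro sum.cong refl) (simp add: commute_time)
  also have "\<dots> = 2 * m * (4 * m * kemeny G)"
    by (simp add: distrib_left sum.distrib H H')
  finally show ?thesis using m_pos by simp
qed

end

subsection \<open>One-sums\<close>

locale one_sum_graphs = G1: walk_graph G1 + G2: walk_graph G2 for G1 G2 :: "'a ugraph" +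
  fixes v :: 'a
  assumes meet: "verts G1 \<inter> verts G2 = {v}"
begin

abbreviation "G \<equiv> one_sum G1 G2"

lemma edges_disjoint: "edges G1 \<inter> edges G2 = {}"
proof (rule ccontr)
  assume "edges G1 \<inter> edges G2 \<noteq> {}"
  then obtain e where "e \<in> edges G1" "e \<in> edges G2" by blast
  then have "e \<subseteq> verts G1 \<inter> verts G2" "card e = 2"
    using G1.simple G2.simple by (auto simp: simple_graph_def)
  then have "e \<subseteq> {v}" "card e = 2" by (simp_all add: meet)
  then show False using card_mono[of "{v}" e] by simp
qed

lemma neighbours_one_sum: "neighbours G x = neighbours G1 x \<union> neighbours G2 x"
  by (auto simp: neighbours_def one_sum_def)

lemma neighbours_disjoint: "neighbours G1 x \<inter> neighbours G2 x = {}"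
  using edges_disjoint by (auto simp: neighbours_def)

lemma vdegree_one_sum: "vdegree G x = vdegree G1 x + vdegree G2 x"
  unfolding vdegree_def neighbours_one_sum
  by (rule card_Un_disjoint) (auto simp: G1.finN G2.finN neighbours_disjoint)

lemma num_edges_one_sum: "num_edges G = num_edges G1 + num_edges G2"
  using edges_disjoint finite_edges[OF G1.simple] finite_edges[OF G2.simple]
  by (simp add: num_edges_def one_sum_def card_Un_disjoint)

lemma lap_one_sum: "lap G u x = lap G1 u x + lap G2 u x"
  unfolding lap_def neighbours_one_sum
  by (rule sum.union_disjoint) (auto simp: G1.finN G2.finN neighbours_disjoint)

lemma verts_one_sum: "verts G = verts G1 \<union> verts G2"
  by (simp add: one_sum_def)

lemma v_in: "v \<in> verts G1" "v \<in> verts G2" using meet by auto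

sublocale G: walk_graph G
proof
  show "simple_graph G"
    using G1.simple G2.simple by (auto simp: simple_graph_def one_sum_def)
  show "edges G \<noteq> {}" using G1.nonempty by (simp add: one_sum_def)
  let ?R = "\<lambda>H :: 'a ugraph. {(a, b). {a, b} \<in> edges H}\<^sup>*"
  have mono: "?R G1 \<subseteq> ?R G" "?R G2 \<subseteq> ?R G"
    by (intro rtrancl_mono; auto simp: one_sum_def)+
  \<comment> \<open>Each vertex is joined to \<open>v\<close> inside its own summand, so
    \<open>v\<close> links any two.\<close>
  have to_v: "(x, v) \<in> ?R G \<and> (v, x) \<in> ?R G" if "x \<in> verts G" for x
    using that mono v_in G1.conn G2.conn by (auto simp: verts_one_sum connected_graph_def)
  show "connected_graph G"
    unfolding connected_graph_def
  proof (intro conjI ballI)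
    show "verts G \<noteq> {}" using v_in by (auto simp: verts_one_sum)
    show "(x, y) \<in> ?R G" if "x \<in> verts G" "y \<in> verts G" for x y
      using to_v[OF that(1)] to_v[OF that(2)] by (blast intro: rtrancl_trans)
  qed
qed

definition ext1 :: "('a \<Rightarrow> real) \<Rightarrow> 'a \<Rightarrow> real" where
  "ext1 w x = (if x \<in> verts G1 then w x else w v)"

lemma ext1_verts2: "x \<in> verts G2 \<Longrightarrow> ext1 w x = w v"
  using meet by (auto simp: ext1_def)

text \<open>The extension is constant on the second summand, so no current flows there, not even out
  of \<open>v\<close>.\<close>

lemma lap_ext1: "lap G (ext1 w) x = (if x \<in> verts G1 then lap G1 w x else 0)"
proof -
  have "lap G1 (ext1 w) x = (if x \<in> verts G1 then lap G1 w x else 0)"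
    using neighbours_outside[OF G1.simple]
    by (auto simp: lap_def ext1_def G1.N_in_V intro!: sum.cong)
  moreover have "lap G2 (ext1 w) x = 0"
  proof (cases "x \<in> verts G2")
    case True
    then show ?thesis by (auto simp: lap_def ext1_verts2 G2.N_in_V intro!: sum.neutral)
  qed (simp add: lap_def neighbours_outside[OF G2.simple])
  ultimately show ?thesis by (simp add: lap_one_sum)
qed

lemma lap_ext1_potential:
  assumes "i \<in> verts G1" "j \<in> verts G1"
  shows "lap G (ext1 (G1.potential i j)) x = unit_vec_at i x - unit_vec_at j x"
  using assms by (auto simp: lap_ext1 G1.lap_potential unit_vec_at_def)

lemma eff_resistance_left:
  assumes "i \<in> verts G1" "j \<in> verts G1"
  shows "eff_resistance G i j = eff_resistance G1 i j"
proof -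
  let ?w = "ext1 (G1.potential i j)"
  have "eff_resistance G i j = ?w i - ?w j"
    by (rule G.eff_resistance_eq_potential_diff)
      (use assms in \<open>auto simp: lap_ext1_potential verts_one_sum\<close>)
  then show ?thesis using assms by (simp add: ext1_def G1.eff_resistance_potential)
qed

end

lemma one_sum_commute: "one_sum G1 G2 = one_sum G2 G1"
  by (simp add: one_sum_def Un_commute)

text \<open>Transfers results on the first summand to the second.\<close>

lemma one_sum_graphs_swap: "one_sum_graphs G1 G2 v \<Longrightarrow> one_sum_graphs G2 G1 v"
  by (simp add: one_sum_graphs_def one_sum_graphs_axioms_def Int_commute)

context one_sum_graphs
begin

interpretation swap: one_sum_graphs G2 G1 v
  by (rule one_sum_graphs_swap) unfold_locales

lemma eff_resistance_right:
  "i \<in> verts G2 \<Longrightarrow> j \<in> verts G2 \<Longrightarrow> eff_resistance G i j = eff_resistance G2 i j"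
  using swap.eff_resistance_left by (simp add: one_sum_commute)

text \<open>Superpose a unit current from \<open>i\<close> to \<open>v\<close> in \<open>G1\<close>
  and one from \<open>v\<close> to \<open>j\<close> in \<open>G2\<close>: source and sink cancel at
  \<open>v\<close>, and the voltage drops add.\<close>

lemma eff_resistance_across:
  assumes "i \<in> verts G1" "j \<in> verts G2"
  shows "eff_resistance G i j = eff_resistance G1 i v + eff_resistance G2 j v"
proof -
  let ?w1 = "ext1 (G1.potential i v)" and ?w2 = "swap.ext1 (G2.potential v j)"
  let ?w = "\<lambda>x. ?w1 x + ?w2 x"
  have "eff_resistance G i j = ?w i - ?w j"
  proof (rule G.eff_resistance_eq_potential_diff)
    fix x
    show "lap G ?w x = unit_vec_at i x - unit_vec_at j x"
      using assms v_in lap_ext1_potential[of i v x] swap.lap_ext1_potential[of v j x]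
      by (simp add: lap_add one_sum_commute[of G2 G1])
  qed (use assms in \<open>auto simp: verts_one_sum\<close>)
  also have "\<dots> = eff_resistance G1 i v + eff_resistance G2 v j"
    using assms v_in
    by (simp add: G1.eff_resistance_potential G2.eff_resistance_potential
        ext1_verts2 swap.ext1_verts2) (simp add: ext1_def swap.ext1_def)
  finally show ?thesis using assms v_in G2.eff_resistance_sym by simp
qed

text \<open>Degrees add at \<open>v\<close>, and a vertex has degree 0 in a summand not containing
  it; so sums split although \<open>v\<close> lies in both.\<close>

lemma sum_degree_one_sum:
  "(\<Sum>i\<in>verts G. real (vdegree G i) * u i)
    = (\<Sum>i\<in>verts G1. real (vdegree G1 i) * u i) + (\<Sum>i\<in>verts G2. real (vdegree G2 i) * u i)"
proof -
  have 1: "(\<Sum>i\<in>verts G. real (vdegree G1 i) * u i) = (\<Sum>i\<in>verts G1. real (vdegree G1 i) * u i)"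
    by (rule sum.mono_neutral_right)
      (auto simp: verts_one_sum G1.finV G2.finV vdegree_def neighbours_outside[OF G1.simple])
  have 2: "(\<Sum>i\<in>verts G. real (vdegree G2 i) * u i) = (\<Sum>i\<in>verts G2. real (vdegree G2 i) * u i)"
    by (rule sum.mono_neutral_right)
      (auto simp: verts_one_sum G1.finV G2.finV vdegree_def neighbours_outside[OF G2.simple])
  show ?thesis by (simp add: vdegree_one_sum distrib_right sum.distrib 1 2)
qed

text \<open>The resistance formula splits into four blocks: two give the summands' Kemeny constants,
  and the two mixed ones agree by symmetry.\<close>

lemma kemeny_one_sum:
  "real (num_edges G) * kemeny G
    = real (num_edges G1) * (kemeny G1 + moment G2 v)
      + real (num_edges G2) * (kemeny G2 + moment G1 v)"
proof -
  let ?d1 = "\<lambda>i. real (vdegree G1 i)" and ?d2 = "\<lambda>i. real (vdegree G2 i)"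
  let ?r = "eff_resistance G"
  have "4 * real (num_edges G) * kemeny G
      = (\<Sum>i\<in>verts G. real (vdegree G i) * (\<Sum>j\<in>verts G. real (vdegree G j) * ?r i j))"
    unfolding G.kemeny_eff_resistance by (simp only: sum_distrib_left mult.assoc)
  also have "\<dots> = (\<Sum>i\<in>verts G1. \<Sum>j\<in>verts G1. ?d1 i * ?d1 j * ?r i j)
      + (\<Sum>i\<in>verts G1. \<Sum>j\<in>verts G2. ?d1 i * ?d2 j * ?r i j)
      + ((\<Sum>i\<in>verts G2. \<Sum>j\<in>verts G1. ?d2 i * ?d1 j * ?r i j)
      + (\<Sum>i\<in>verts G2. \<Sum>j\<in>verts G2. ?d2 i * ?d2 j * ?r i j))"
    unfolding sum_degree_one_sum by (simp add: distrib_left sum.distrib sum_distrib_left mult.assoc)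
  also have "(\<Sum>i\<in>verts G1. \<Sum>j\<in>verts G1. ?d1 i * ?d1 j * ?r i j) = 4 * G1.m * kemeny G1"
    unfolding G1.kemeny_eff_resistance by (intro sum.cong) (auto simp: eff_resistance_left)
  also have "(\<Sum>i\<in>verts G2. \<Sum>j\<in>verts G2. ?d2 i * ?d2 j * ?r i j) = 4 * G2.m * kemeny G2"
    unfolding G2.kemeny_eff_resistance by (intro sum.cong) (auto simp: eff_resistance_right)
  also have "(\<Sum>i\<in>verts G2. \<Sum>j\<in>verts G1. ?d2 i * ?d1 j * ?r i j)
      = (\<Sum>i\<in>verts G1. \<Sum>j\<in>verts G2. ?d1 i * ?d2 j * ?r i j)"
    by (subst sum.swap, intro sum.cong refl)
      (auto simp: verts_one_sum G.eff_resistance_sym)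
  also have "(\<Sum>i\<in>verts G1. \<Sum>j\<in>verts G2. ?d1 i * ?d2 j * ?r i j)
      = (\<Sum>i\<in>verts G1. \<Sum>j\<in>verts G2. (?d1 i * eff_resistance G1 i v) * ?d2 j
          + ?d1 i * (?d2 j * eff_resistance G2 j v))"
    by (intro sum.cong refl) (simp add: eff_resistance_across algebra_simps)
  \<comment> \<open>Resistance across \<open>v\<close> is a sum of one-variable terms, so each
    double sum factors into a moment and a degree sum.\<close>
  also have "\<dots> = moment G1 v * (2 * G2.m) + (2 * G1.m) * moment G2 v"
    unfolding moment_def sum_vdegree[OF G1.simple, symmetric] sum_vdegree[OF G2.simple, symmetric]
    by (simp add: sum.distrib sum_product)
  finally show ?thesis by (simp add: algebra_simps)
qed

end

section \<open>Adding edges inside one summand\<close>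

theorem theorem4p2:
  fixes G1 G2 G Ghat G2hat :: "'a ugraph"
    and v :: 'a
    and L :: "'a set set"
    and l m1 m2 m :: nat
    and A B C :: real
  assumes "simple_graph G1" "connected_graph G1" "edges G1 \<noteq> {}"
    and "simple_graph G2" "connected_graph G2" "edges G2 \<noteq> {}"
    and "verts G1 \<inter> verts G2 = {v}"
    and "G = one_sum G1 G2"
    and "m1 = num_edges G1" "m2 = num_edges G2" "m = m1 + m2"
    and "L \<subseteq> {{x, y} | x y. x \<in> verts G2 \<and> y \<in> verts G2 \<and> x \<noteq> y}"
    and "L \<inter> edges G = {}"
    and "l = card L"
    and "Ghat = add_edges G L"
    and "G2hat = add_edges G2 L"
    and "A = moment G2hat v - moment G2 v"
    and "B = kemeny G2hat - moment G2 v"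
    and "C = kemeny G2hat - kemeny G2"
  shows "kemeny Ghat - kemeny G =
    real l * real m1 * (moment G1 v - kemeny G1) / (real m * (real m + real l)) +
    (A * (real m1)\<^sup>2 + ((A + C) * real m2 + B * real l) * real m1
       + C * ((real m2)\<^sup>2 + real l * real m2)) / (real m * (real m + real l))"
proof -
  interpret S: one_sum_graphs G1 G2 v by unfold_locales (use assms in auto)
  have L: "\<forall>e\<in>L. e \<subseteq> verts G2 \<and> card e = 2" using assms(12) by auto
  have simple2: "simple_graph G2hat"
    using assms(4) L by (auto simp: assms(16) simple_graph_def add_edges_def)
  interpret S': one_sum_graphs G1 G2hat v
  proof unfold_locales
    show "simple_graph G2hat" by (rule simple2)
    have "{(a, b). {a, b} \<in> edges G2}\<^sup>* \<subseteq> {(a, b). {a, b} \<in> edges G2hat}\<^sup>*"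
      by (intro rtrancl_mono) (auto simp: assms(16) add_edges_def)
    then show "connected_graph G2hat"
      using assms(5) by (auto simp: connected_graph_def assms(16) add_edges_def)
    show "edges G2hat \<noteq> {}" "verts G1 \<inter> verts G2hat = {v}"
      using assms(6,7) by (auto simp: assms(16) add_edges_def)
  qed
  have Ghat: "Ghat = one_sum G1 G2hat" by (simp add: assms(8,15,16) add_edges_one_sum)
  have m2hat: "num_edges G2hat = m2 + l"
  proof -
    \<comment> \<open>The new pairs avoid the edges of \<open>G\<close>, hence those of
      \<open>G2\<close>, so the edge counts add.\<close>
    have "finite L" "edges G2 \<inter> L = {}"
      using finite_edges[OF simple2] assms(8,13) by (auto simp: assms(16) add_edges_def one_sum_def)
    then show ?thesis
      using finite_edges[OF assms(4)]
      by (simp add: assms(10,14,16) num_edges_def add_edges_def card_Un_disjoint)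
  qed
  have pos: "real m > 0" using S.G1.m_pos assms(9,11) by simp
  have K: "kemeny G = (m1 * (kemeny G1 + moment G2 v) + m2 * (kemeny G2 + moment G1 v)) / m"
    using S.kemeny_one_sum pos by (simp add: S.num_edges_one_sum assms(8-11) field_simps)
  have K': "kemeny Ghat = (m1 * (kemeny G1 + moment G2hat v)
      + (m2 + l) * (kemeny G2hat + moment G1 v)) / (m + l)"
    using S'.kemeny_one_sum pos
    by (simp add: S'.num_edges_one_sum m2hat Ghat assms(9-11) field_simps)
  have "real m + real l > 0" using pos by simp
  then have "kemeny Ghat - kemeny G =
      (m * (m1 * (kemeny G1 + moment G2hat v) + (m2 + l) * (kemeny G2hat + moment G1 v))
      - (m + l) * (m1 * (kemeny G1 + moment G2 v) + m2 * (kemeny G2 + moment G1 v)))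
      / (real m * (real m + real l))"
    unfolding K K' using pos by (simp add: field_simps)
  \<comment> \<open>Over the common denominator, only a polynomial identity in the moments, Kemeny
    constants and edge counts remains.\<close>
  also have "\<dots> = (real l * real m1 * (moment G1 v - kemeny G1)
      + (A * (real m1)\<^sup>2 + ((A + C) * real m2 + B * real l) * real m1
       + C * ((real m2)\<^sup>2 + real l * real m2))) / (real m * (real m + real l))"
    unfolding assms(11,17-19)
    by (rule arg_cong2[where f = "(/)"]) (auto simp: algebra_simps power2_eq_square)
  finally show ?thesis by (simp only: add_divide_distrib)
qed

end
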